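(* Consider the network and the two optimization problems $(\mathrm{L}:\mathcal C(\boldsymbol x_i,\boldsymbol\zeta_{\mathcal N_i}),\mathcal F(\mathbb R^{N_{x,i}}))$ and $(\mathrm{L}:\mathcal{SC}(\boldsymbol\xi_i,\boldsymbol\zeta_{\mathcal N_i}),\mathcal F(\mathbb R^{N_{x,i}}))$ defined in the context. These problems are equivalent in the following sense. Given feasible state/disturbance feedback policies $\boldsymbol\psi_i$, $i\in\mathcal M$ (together with state forecast sets $\mathcal X_i$), for $(\mathrm{L}:\mathcal C(\boldsymbol x_i,\boldsymbol\zeta_{\mathcal N_i}),\mathcal F(\mathbb R^{N_{x,i}}))$, one can construct disturbance feedback policies $\boldsymbol\Psi_i$, $i\in\mathcal M$, which (together with the same sets $\mathcal X_i$) are feasible for $(\mathrm{L}:\mathcal{SC}(\boldsymbol\xi_i,\boldsymbol\zeta_{\mathcal N_i}),\mathcal F(\mathbb R^{N_{x,i}}))$ and achieve the same objective value; and vice versa, given feasible disturbance feedback policies $\boldsymbol\Psi_i$ (with sets $\mathcal X_i$) for the latter problem, one can construct state/disturbance feedback policies $\boldsymbol\psi_i$ which (with the same sets) are feasible for the former problem and achieve the same objective value.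
   Context: **Network.** Let $M,T\in\mathbb N$, $\mathcal M=\{1,\dots,M\}$, $\mathcal T=\{1,\dots,T\}$, $\mathcal T_+=\{1,\dots,T+1\}$. Agents $i\in\mathcal M$ are the nodes of a directed graph; $\mathcal N_i\subset\mathcal M$ is the set of agents $j$ with an arc from $j$ to $i$ (neighbors of $i$). **Notation.** A subscript $\mathcal N_i$ denotes concatenation over $j\in\mathcal N_i$; for a time-dependent vector $\nu_{i,t}$, $\boldsymbol\nu_i^t=(\nu_{i,1},\dots,\nu_{i,t})$ is its history up to time $t$ (empty for $t=0$), and $\boldsymbol\nu_{\mathcal N_i}^t=[\boldsymbol\nu_j^t]_{j\in\mathcal N_i}$. **Dynamics, constraints, cost.** Agent $i$ has states $x_{i,t}\in\mathbb R^{n_{x,i}}$ ($t\in\mathcal T_+$, $x_{i,1}$ known), inputs $u_{i,t}\in\mathbb R^{n_{u,i}}$, disturbances $\xi_{i,t}\in\mathbb R^{n_{\xi,i}}$ ($t\in\mathcal T$). Known matrices $A_{i,t},B_{i,t},D_{i,t},E_{i,t}$ of full column rank are given. For $\boldsymbol\zeta_{\mathcal N_i}$ (in the role of neighbor states), $\boldsymbol x_i=f_i(\boldsymbol\zeta_{\mathcal N_i},\boldsymbol u_i,\boldsymbol\xi_i)$ means $$x_{i,t+1}=A_{i,t}x_{i,t}+B_{i,t}\boldsymbol\zeta_{\mathcal N_i,t}+D_{i,t}u_{i,t}+E_{i,t}\xi_{i,t},\quad t\in\mathcal T,$$ where $\boldsymbol x_i=[x_{i,t}]_{t\in\mathcal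 T_+}\in\mathbb R^{N_{x,i}}$, $N_{x,i}=(T+1)n_{x,i}$, $\boldsymbol u_i=[u_{i,t}]_{t\in\mathcal T}$, $\boldsymbol\xi_i=[\xi_{i,t}]_{t\in\mathcal T}$. Operational constraints: $\mathcal O_i=\{(\boldsymbol x_i,\boldsymbol u_i): H_{x,i}\boldsymbol x_i+H_{u,i}\boldsymbol u_i\le h_i\}$. Cost: $J_i(\boldsymbol x_i,\boldsymbol u_i)=\sum_{t=1}^T(\|Q_ix_{i,t}\|_p+\|R_iu_{i,t}\|_p)$, $p\in\{1,2,\infty\}$. Disturbances: $\boldsymbol\xi_i\in\Xi_i$, a nonempty compact polyhedron. **State forecast sets and beliefs.** $\mathcal F(\mathbb R^{N_{x,i}})$ is the collection of compact subsets of $\mathbb R^{N_{x,i}}$. A state forecast set is $\mathcal X_i\in\mathcal F(\mathbb R^{N_{x,i}})$; $\mathcal X_{\mathcal N_i}=\prod_{j\in\mathcal N_i}\mathcal X_j$. Beliefs $\boldsymbol\zeta_j=[\zeta_{j,t}]_{t\in\mathcal T_+}$, $\zeta_{j,t}\in\mathbb R^{n_{x,j}}$, range over $\mathcal X_j$. **Policies.** $\mathcal C(\boldsymbol x_i,\boldsymbol\zeta_{\mathcal N_i})$: families $\boldsymbol\psi_i=[\psi_{i,t}]_{t\in\mathcal T}$ of functions giving $u_{i,t}=\psi_{i,t}(\boldsymbol x_i^t,\boldsymbol\zeta_{\mathcal N_i}^t)$ (causal local state/disturbance feedback). $\mathcal{SC}(\boldsymbol\xi_i,\boldsymbol\zeta_{\mathcal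 N_i})$: families $\boldsymbol\Psi_i=[\Psi_{i,t}]_{t\in\mathcal T}$ of functions giving $u_{i,t}=\Psi_{i,t}(\boldsymbol\xi_i^{t-1},\boldsymbol\zeta_{\mathcal N_i}^t)$ (disturbance feedback, strictly causal in $\boldsymbol\xi_i$, causal in $\boldsymbol\zeta_{\mathcal N_i}$). **Problem $(\mathrm{L}:\mathcal C(\boldsymbol x_i,\boldsymbol\zeta_{\mathcal N_i}),\mathcal F(\mathbb R^{N_{x,i}}))$:** minimize $\sum_{i=1}^M\max_{\boldsymbol\xi_i\in\Xi_i,\,\boldsymbol\zeta_{\mathcal N_i}\in\mathcal X_{\mathcal N_i}}J_i(\boldsymbol x_i,\boldsymbol u_i)$ over $\boldsymbol\psi_i\in\mathcal C(\boldsymbol x_i,\boldsymbol\zeta_{\mathcal N_i})$ and $\mathcal X_i\in\mathcal F(\mathbb R^{N_{x,i}})$, $i\in\mathcal M$, subject to, for all $i\in\mathcal M$, all $\boldsymbol\xi_i\in\Xi_i$ and all $\boldsymbol\zeta_{\mathcal N_i}\in\mathcal X_{\mathcal N_i}$: $\boldsymbol u_i=\boldsymbol\psi_i(\boldsymbol x_i,\boldsymbol\zeta_{\mathcal N_i})$, $\boldsymbol x_i=f_i(\boldsymbol\zeta_{\mathcal N_i},\boldsymbol u_i,\boldsymbol\xi_i)$, $(\boldsymbol x_i,\boldsymbol u_i)\in\mathcal O_i$, $\boldsymbol x_i\in\mathcal X_i$. **Problem $(\mathrm{L}:\mathcal{SC}(\boldsymbol\xi_i,\boldsymbol\zeta_{\mathcal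 N_i}),\mathcal F(\mathbb R^{N_{x,i}}))$:** the same problem with $\boldsymbol\psi_i$ replaced by $\boldsymbol\Psi_i\in\mathcal{SC}(\boldsymbol\xi_i,\boldsymbol\zeta_{\mathcal N_i})$ and $\boldsymbol u_i=\boldsymbol\Psi_i(\boldsymbol\xi_i,\boldsymbol\zeta_{\mathcal N_i})$. "max" is read as supremum. *)

theory Defs
  imports
    "HOL-Analysis.Analysis"
    "Jordan_Normal_Form.DL_Rank"
begin

unbundle no vec_syntax
hide_type (open) Finite_Cartesian_Product.vec
hide_const (open) Finite_Cartesian_Product.vec

text \<open>
  All dimensions depend on the agent, so vectors and matrices are taken from
  \<^theory>\<open>Jordan_Normal_Form.Matrix\<close>. A signal \<open>[\<nu>\<^sub>t]\<close> with \<open>\<nu>\<^sub>t \<in> \<real>\<^sup>n\<close> is a function from time to vectors,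
  extensional on its time range, so that signals on the same range are equal iff they agree there.
\<close>

type_synonym signal = "nat \<Rightarrow> real vec"

definition signals :: "nat \<Rightarrow> nat \<Rightarrow> signal set" where
  "signals t n = (\<Pi>\<^sub>E s \<in> {1..t}. carrier_vec n)"

definition history :: "nat \<Rightarrow> signal \<Rightarrow> signal" where
  "history t \<nu> = restrict \<nu> {1..t}"

definition concat_vecs :: "real vec list \<Rightarrow> real vec" where
  "concat_vecs vs = vec_of_list (concat (map list_of_vec vs))"

definition stack :: "nat \<Rightarrow> signal \<Rightarrow> real vec" where
  "stack t \<nu> = concat_vecs (map \<nu> [1..<Suc t])"

text \<open>
  \<^const>\<open>Euclidean_space\<close>\<open> n\<close> realizes \<open>\<real>\<^sup>n\<close> as the sequences that vanish from index \<open>n\<close> on;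
  \<open>coords\<close> is the identification with it. It supplies the topology on \<open>carrier_vec n\<close>.
\<close>

definition coords :: "real vec \<Rightarrow> nat \<Rightarrow> real" where
  "coords v = (\<lambda>k. if k < dim_vec v then v $ k else 0)"

definition compact_signals :: "nat \<Rightarrow> nat \<Rightarrow> signal set \<Rightarrow> bool" where
  "compact_signals t n S \<longleftrightarrow>
     S \<subseteq> signals t n \<and> compactin (Euclidean_space (t * n)) ((\<lambda>\<nu>. coords (stack t \<nu>)) ` S)"

definition polyhedral_signals :: "nat \<Rightarrow> nat \<Rightarrow> signal set \<Rightarrow> bool" where
  "polyhedral_signals t n S \<longleftrightarrow>
     (\<exists>m W w. W \<in> carrier_mat m (t * n) \<and> w \<in> carrier_vec m \<and>
        S = {\<nu> \<in> signals t n. W *\<^sub>v stack t \<nu> \<le> w})"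

definition full_column_rank :: "real mat \<Rightarrow> bool" where
  "full_column_rank A \<longleftrightarrow> vec_space.rank (dim_row A) A = dim_col A"

definition p_norm :: "ereal \<Rightarrow> real vec \<Rightarrow> real" where
  "p_norm p v =
     (if p = \<infinity> then Max (insert 0 ((\<lambda>k. \<bar>v $ k\<bar>) ` {..<dim_vec v}))
      else (\<Sum>k<dim_vec v. \<bar>v $ k\<bar> powr real_of_ereal p) powr (1 / real_of_ereal p))"

text \<open>
  Agents are \<open>1, \<dots>, agents\<close>. The operational constraints of agent \<open>i\<close> have \<open>dim_h i\<close> rows.
\<close>

record network =
  agents :: nat
  horizon :: nat
  nbrs :: "nat \<Rightarrow> nat set"
  dim_x :: "nat \<Rightarrow> nat"
  dim_u :: "nat \<Rightarrow> nat"
  dim_d :: "nat \<Rightarrow> nat"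
  dim_h :: "nat \<Rightarrow> nat"
  x_init :: "nat \<Rightarrow> real vec"
  mat_A :: "nat \<Rightarrow> nat \<Rightarrow> real mat"
  mat_B :: "nat \<Rightarrow> nat \<Rightarrow> real mat"
  mat_D :: "nat \<Rightarrow> nat \<Rightarrow> real mat"
  mat_E :: "nat \<Rightarrow> nat \<Rightarrow> real mat"
  mat_Hx :: "nat \<Rightarrow> real mat"
  mat_Hu :: "nat \<Rightarrow> real mat"
  vec_h :: "nat \<Rightarrow> real vec"
  mat_Q :: "nat \<Rightarrow> real mat"
  mat_R :: "nat \<Rightarrow> real mat"
  norm_p :: ereal
  dist_set :: "nat \<Rightarrow> signal set"

text \<open>Neighbours are concatenated in increasing order of their index.\<close>

definition nbr_vec :: "network \<Rightarrow> nat \<Rightarrow> (nat \<Rightarrow> signal) \<Rightarrow> nat \<Rightarrow> real vec" where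
  "nbr_vec G i \<zeta> t = concat_vecs (map (\<lambda>j. \<zeta> j t) (sorted_list_of_set (nbrs G i)))"

definition wf_network :: "network \<Rightarrow> bool" where
  "wf_network G \<longleftrightarrow>
     norm_p G \<in> {1, 2, \<infinity>} \<and>
     (\<forall>i \<in> {1..agents G}.
        nbrs G i \<subseteq> {1..agents G} \<and>
        x_init G i \<in> carrier_vec (dim_x G i) \<and>
        (\<forall>t \<in> {1..horizon G}.
           mat_A G i t \<in> carrier_mat (dim_x G i) (dim_x G i) \<and>
           mat_B G i t \<in> carrier_mat (dim_x G i) (\<Sum>j \<in> nbrs G i. dim_x G j) \<and>
           mat_D G i t \<in> carrier_mat (dim_x G i) (dim_u G i) \<and>
           mat_E G i t \<in> carrier_mat (dim_x G i) (dim_d G i) \<and>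
           full_column_rank (mat_A G i t) \<and>
           full_column_rank (mat_B G i t) \<and>
           full_column_rank (mat_D G i t) \<and>
           full_column_rank (mat_E G i t)) \<and>
        mat_Hx G i \<in> carrier_mat (dim_h G i) ((horizon G + 1) * dim_x G i) \<and>
        mat_Hu G i \<in> carrier_mat (dim_h G i) (horizon G * dim_u G i) \<and>
        vec_h G i \<in> carrier_vec (dim_h G i) \<and>
        dim_col (mat_Q G i) = dim_x G i \<and>
        dim_col (mat_R G i) = dim_u G i \<and>
        dist_set G i \<noteq> {} \<and>
        compact_signals (horizon G) (dim_d G i) (dist_set G i) \<and>
        polyhedral_signals (horizon G) (dim_d G i) (dist_set G i))"

definition dynamics ::
  "network \<Rightarrow> nat \<Rightarrow> (nat \<Rightarrow> signal) \<Rightarrow> signal \<Rightarrow> signal \<Rightarrow> signal \<Rightarrow> bool" where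
  "dynamics G i \<zeta> u \<xi> x \<longleftrightarrow>
     x \<in> signals (horizon G + 1) (dim_x G i) \<and>
     x 1 = x_init G i \<and>
     (\<forall>t \<in> {1..horizon G}.
        x (t + 1) = mat_A G i t *\<^sub>v x t + mat_B G i t *\<^sub>v nbr_vec G i \<zeta> t +
                    mat_D G i t *\<^sub>v u t + mat_E G i t *\<^sub>v \<xi> t)"

definition op_constraints :: "network \<Rightarrow> nat \<Rightarrow> (signal \<times> signal) set" where
  "op_constraints G i =
     {(x, u). x \<in> signals (horizon G + 1) (dim_x G i) \<and> u \<in> signals (horizon G) (dim_u G i) \<and>
        mat_Hx G i *\<^sub>v stack (horizon G + 1) x + mat_Hu G i *\<^sub>v stack (horizon G) u \<le> vec_h G i}"

definition cost :: "network \<Rightarrow> nat \<Rightarrow> signal \<Rightarrow> signal \<Rightarrow> real" where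
  "cost G i x u =
     (\<Sum>t = 1..horizon G. p_norm (norm_p G) (mat_Q G i *\<^sub>v x t) + p_norm (norm_p G) (mat_R G i *\<^sub>v u t))"

definition forecast_sets :: "network \<Rightarrow> nat \<Rightarrow> signal set set" where
  "forecast_sets G i = {S. compact_signals (horizon G + 1) (dim_x G i) S}"

definition beliefs :: "network \<Rightarrow> (nat \<Rightarrow> signal set) \<Rightarrow> nat \<Rightarrow> (nat \<Rightarrow> signal) set" where
  "beliefs G X i = (\<Pi>\<^sub>E j \<in> nbrs G i. X j)"

definition nbr_history :: "network \<Rightarrow> nat \<Rightarrow> nat \<Rightarrow> (nat \<Rightarrow> signal) \<Rightarrow> nat \<Rightarrow> signal" where
  "nbr_history G i t \<zeta> = (\<lambda>j \<in> nbrs G i. history t (\<zeta> j))"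

definition nbr_histories :: "network \<Rightarrow> nat \<Rightarrow> nat \<Rightarrow> (nat \<Rightarrow> signal) set" where
  "nbr_histories G i t = (\<Pi>\<^sub>E j \<in> nbrs G i. signals t (dim_x G j))"

text \<open>
  A policy receives, besides the time \<open>t\<close>, only the histories it may depend on; causality
  is thus expressed by its arguments.
\<close>

type_synonym policy = "nat \<Rightarrow> signal \<Rightarrow> (nat \<Rightarrow> signal) \<Rightarrow> real vec"

definition state_policies :: "network \<Rightarrow> nat \<Rightarrow> policy set" where
  "state_policies G i =
     {\<psi>. \<forall>t \<in> {1..horizon G}.
        \<psi> t \<in> signals t (dim_x G i) \<rightarrow> nbr_histories G i t \<rightarrow> carrier_vec (dim_u G i)}"

definition dist_policies :: "network \<Rightarrow> nat \<Rightarrow> policy set" where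
  "dist_policies G i =
     {\<Psi>. \<forall>t \<in> {1..horizon G}.
        \<Psi> t \<in> signals (t - 1) (dim_d G i) \<rightarrow> nbr_histories G i t \<rightarrow> carrier_vec (dim_u G i)}"

definition state_loop ::
  "network \<Rightarrow> nat \<Rightarrow> policy \<Rightarrow> signal \<Rightarrow> (nat \<Rightarrow> signal) \<Rightarrow> signal \<Rightarrow> signal \<Rightarrow> bool" where
  "state_loop G i \<psi> \<xi> \<zeta> x u \<longleftrightarrow>
     u \<in> signals (horizon G) (dim_u G i) \<and>
     (\<forall>t \<in> {1..horizon G}. u t = \<psi> t (history t x) (nbr_history G i t \<zeta>)) \<and>
     dynamics G i \<zeta> u \<xi> x"

definition dist_loop ::
  "network \<Rightarrow> nat \<Rightarrow> policy \<Rightarrow> signal \<Rightarrow> (nat \<Rightarrow> signal) \<Rightarrow> signal \<Rightarrow> signal \<Rightarrow> bool" where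
  "dist_loop G i \<Psi> \<xi> \<zeta> x u \<longleftrightarrow>
     u \<in> signals (horizon G) (dim_u G i) \<and>
     (\<forall>t \<in> {1..horizon G}. u t = \<Psi> t (history (t - 1) \<xi>) (nbr_history G i t \<zeta>)) \<and>
     dynamics G i \<zeta> u \<xi> x"

text \<open>
  By causality each policy determines exactly one pair \<open>(x, u)\<close> for given \<open>(\<xi>, \<zeta>)\<close>, so the
  existential quantifiers over \<open>x\<close> and \<open>u\<close> below refer to that pair.
\<close>

definition state_feasible :: "network \<Rightarrow> (nat \<Rightarrow> policy) \<Rightarrow> (nat \<Rightarrow> signal set) \<Rightarrow> bool" where
  "state_feasible G \<psi> X \<longleftrightarrow>
     (\<forall>i \<in> {1..agents G}.
        \<psi> i \<in> state_policies G i \<and> X i \<in> forecast_sets G i \<and>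
        (\<forall>\<xi> \<in> dist_set G i. \<forall>\<zeta> \<in> beliefs G X i.
           \<exists>x u. state_loop G i (\<psi> i) \<xi> \<zeta> x u \<and> (x, u) \<in> op_constraints G i \<and> x \<in> X i))"

definition dist_feasible :: "network \<Rightarrow> (nat \<Rightarrow> policy) \<Rightarrow> (nat \<Rightarrow> signal set) \<Rightarrow> bool" where
  "dist_feasible G \<Psi> X \<longleftrightarrow>
     (\<forall>i \<in> {1..agents G}.
        \<Psi> i \<in> dist_policies G i \<and> X i \<in> forecast_sets G i \<and>
        (\<forall>\<xi> \<in> dist_set G i. \<forall>\<zeta> \<in> beliefs G X i.
           \<exists>x u. dist_loop G i (\<Psi> i) \<xi> \<zeta> x u \<and> (x, u) \<in> op_constraints G i \<and> x \<in> X i))"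

text \<open>
  The worst-case costs are suprema in the extended reals: policies need not be
  continuous, so a supremum may be infinite, and over an empty set of beliefs it is \<open>-\<infinity>\<close>.
\<close>

definition state_objective :: "network \<Rightarrow> (nat \<Rightarrow> policy) \<Rightarrow> (nat \<Rightarrow> signal set) \<Rightarrow> ereal" where
  "state_objective G \<psi> X =
     (\<Sum>i = 1..agents G.
        Sup {ereal (cost G i x u) | \<xi> \<zeta> x u.
               \<xi> \<in> dist_set G i \<and> \<zeta> \<in> beliefs G X i \<and> state_loop G i (\<psi> i) \<xi> \<zeta> x u})"

definition dist_objective :: "network \<Rightarrow> (nat \<Rightarrow> policy) \<Rightarrow> (nat \<Rightarrow> signal set) \<Rightarrow> ereal" where
  "dist_objective G \<Psi> X =
     (\<Sum>i = 1..agents G.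
        Sup {ereal (cost G i x u) | \<xi> \<zeta> x u.
               \<xi> \<in> dist_set G i \<and> \<zeta> \<in> beliefs G X i \<and> dist_loop G i (\<Psi> i) \<xi> \<zeta> x u})"

end

theory Submission
  imports Defs
begin

text \<open>
  Both kinds of policy see the same beliefs, so the question is whether, along a closed loop, the
  local state history \<open>x\<^sub>1, \<dots>, x\<^sub>t\<close> and the disturbance history \<open>\<xi>\<^sub>1, \<dots>, \<xi>\<^sub>t\<^sub>-\<^sub>1\<close> carry the same
  information once the beliefs up to time \<open>t\<close> are known. They do. Under a state feedback policy, the
  past disturbances and beliefs fix the states by simulating the dynamics (\<open>state_loop_causal\<close>).
  Under a disturbance feedback policy, the states fix the past disturbances: by induction on time the
  earlier disturbances are known, hence so is the input, and the dynamics then give \<open>E\<^sub>t \<xi>\<^sub>t\<close>, from which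
  \<open>\<xi>\<^sub>t\<close> is recovered because \<open>E\<^sub>t\<close> has full column rank (\<open>dist_loop_reconstruct\<close>).

  In either case the input applied at time \<open>t\<close> is a function of what the other kind of policy sees.
  Instead of writing this function down by recursion, it is read off from the set of all closed-loop
  runs, and set to zero on data that no run produces
  (\<open>causal_policy_exists\<close>). The runs of the given loop are then runs of the new loop. For given
  disturbance and belief the new loop has at most one run, and feasibility provides one of the given
  loop, so the two loops have the same run. As this holds for every disturbance and belief that the
  constraints and the objective range over, the same forecast sets are feasible and the worst-case
  costs agree.
\<close>

section \<open>Injectivity of matrices of full column rank\<close>

text \<open>
  The facts on full rank and linear independence used below speak of the set of columns, which
  reflects the kernel only if no column is repeated. A repeated column would leave fewer than
  \<open>nc\<close> vectors to span the column space.
\<close>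

lemma (in vec_space) distinct_cols_if_rank_eq_cols:
  assumes A: "A \<in> carrier_mat n nc" and "rank A = nc"
  shows "distinct (cols A)"
proof (rule card_distinct)
  obtain S where S: "maximal S (\<lambda>U. U \<subseteq> set (cols A) \<and> lin_indpt U)"
    using maximal_exists[of "\<lambda>U. U \<subseteq> set (cols A) \<and> lin_indpt U" "card (set (cols A))" "{}"]
    by (meson List.finite_set card_mono empty_iff empty_subsetI finite_lin_indpt2 rev_finite_subset)
  have "card S = nc"
    using rank_card_indpt[OF A S] assms(2) by simp
  moreover have "card S \<le> card (set (cols A))"
    using S by (intro card_mono) (auto simp: maximal_def)
  ultimately show "card (set (cols A)) = length (cols A)"
    using card_length[of "cols A"] A by simp
qed

lemma full_column_rank_inj:
  assumes full: "full_column_rank A"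
    and v: "v \<in> carrier_vec (dim_col A)" and w: "w \<in> carrier_vec (dim_col A)"
    and eq: "A *\<^sub>v v = A *\<^sub>v w"
  shows "v = w"
proof -
  let ?n = "dim_row A" and ?m = "dim_col A"
  have A: "A \<in> carrier_mat ?n ?m" by simp
  have rank: "vec_space.rank ?n A = ?m"
    using full by (simp add: full_column_rank_def)
  have dist: "distinct (cols A)"
    by (rule vec_space.distinct_cols_if_rank_eq_cols[OF A rank])
  have indpt: "module.lin_indpt class_ring (module_vec TYPE(real) ?n) (set (cols A))"
    using vec_space.full_rank_lin_indpt[OF A rank dist] .
  have "A *\<^sub>v (v - w) = 0\<^sub>v ?n"
    unfolding mult_minus_distrib_mat_vec[OF A v w] eq by (intro eq_vecI) auto
  then have "v - w = 0\<^sub>v ?m"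
    using vec_space.lin_depI[OF A _ _ _ dist, of "v - w"] indpt v w by auto
  then show ?thesis
    using v w by (simp add: vec_eq_iff)
qed

section \<open>Information determining a trajectory\<close>

lemma restrict_eq_iff: "restrict f A = restrict g A \<longleftrightarrow> (\<forall>a\<in>A. f a = g a)"
  by (metis restrict_apply' restrict_ext)

lemma history_eq_iff:
  "history t \<nu> = history t \<nu>' \<longleftrightarrow> (\<forall>s\<in>{1..t}. \<nu> s = \<nu>' s)"
  by (simp add: history_def restrict_eq_iff)

lemma nbr_history_eq_iff:
  "nbr_history G i t \<zeta> = nbr_history G i t \<zeta>' \<longleftrightarrow>
     (\<forall>j\<in>nbrs G i. \<forall>s\<in>{1..t}. \<zeta> j s = \<zeta>' j s)"
  by (simp add: nbr_history_def restrict_eq_iff history_eq_iff)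

lemma history_eq_mono:
  "history t \<nu> = history t \<nu>' \<Longrightarrow> s \<le> t \<Longrightarrow> history s \<nu> = history s \<nu>'"
  by (simp add: history_eq_iff)

lemma nbr_history_eq_mono:
  "nbr_history G i t \<zeta> = nbr_history G i t \<zeta>' \<Longrightarrow> s \<le> t \<Longrightarrow>
     nbr_history G i s \<zeta> = nbr_history G i s \<zeta>'"
  by (simp add: nbr_history_eq_iff)

lemma finite_nbrs: "wf_network G \<Longrightarrow> i \<in> {1..agents G} \<Longrightarrow> finite (nbrs G i)"
  by (rule finite_subset[of _ "{1..agents G}"]) (simp_all add: wf_network_def)

lemma nbr_vec_cong:
  assumes "finite (nbrs G i)" "nbr_history G i t \<zeta> = nbr_history G i t \<zeta>'" "1 \<le> t"
  shows "nbr_vec G i \<zeta> t = nbr_vec G i \<zeta>' t"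
  unfolding nbr_vec_def using assms
  by (intro arg_cong[of _ _ concat_vecs] map_cong) (auto simp: nbr_history_eq_iff)

lemma signals_eqI:
  "\<nu> \<in> signals t n \<Longrightarrow> \<nu>' \<in> signals t n \<Longrightarrow> history t \<nu> = history t \<nu>' \<Longrightarrow> \<nu> = \<nu>'"
  unfolding signals_def history_eq_iff by (rule PiE_ext) auto

lemma history_SucI:
  "history t \<nu> = history t \<nu>' \<Longrightarrow> \<nu> (Suc t) = \<nu>' (Suc t) \<Longrightarrow> history (Suc t) \<nu> = history (Suc t) \<nu>'"
  by (auto simp: history_eq_iff le_Suc_eq)

lemma dynamics_step:
  assumes "finite (nbrs G i)"
    and "dynamics G i \<zeta> u \<xi> x" "dynamics G i \<zeta>' u' \<xi>' x'"
    and "1 \<le> t" "t \<le> horizon G"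
    and "x t = x' t" "u t = u' t" "\<xi> t = \<xi>' t"
    and "nbr_history G i t \<zeta> = nbr_history G i t \<zeta>'"
  shows "x (Suc t) = x' (Suc t)"
  using assms nbr_vec_cong[of G i t \<zeta> \<zeta>'] by (simp add: dynamics_def)

lemma dynamics_init:
  "dynamics G i \<zeta> u \<xi> x \<Longrightarrow> dynamics G i \<zeta>' u' \<xi>' x' \<Longrightarrow> history 1 x = history 1 x'"
  by (simp add: dynamics_def history_eq_iff)

text \<open>
  This is where the full column rank of \<open>E\<^sub>t\<close> enters: when everything else in the state update
  agrees, so do \<open>E\<^sub>t \<xi>\<^sub>t\<close> and \<open>E\<^sub>t \<xi>'\<^sub>t\<close>.
\<close>

lemma dynamics_disturbance_cancel:
  assumes wf: "wf_network G" and i: "i \<in> {1..agents G}"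
    and dyn: "dynamics G i \<zeta> u \<xi> x" "dynamics G i \<zeta>' u' \<xi>' x'"
    and \<xi>: "\<xi> \<in> signals (horizon G) (dim_d G i)" "\<xi>' \<in> signals (horizon G) (dim_d G i)"
    and t: "1 \<le> t" "t \<le> horizon G"
    and eq: "x t = x' t" "x (Suc t) = x' (Suc t)" "u t = u' t"
      "nbr_history G i t \<zeta> = nbr_history G i t \<zeta>'"
  shows "\<xi> t = \<xi>' t"
proof -
  have E: "mat_E G i t \<in> carrier_mat (dim_x G i) (dim_d G i)" "full_column_rank (mat_E G i t)"
    using wf i t by (simp_all add: wf_network_def)
  define a where
    "a = mat_A G i t *\<^sub>v x t + mat_B G i t *\<^sub>v nbr_vec G i \<zeta> t + mat_D G i t *\<^sub>v u t"
  have nv: "nbr_vec G i \<zeta> t = nbr_vec G i \<zeta>' t"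
    by (rule nbr_vec_cong[OF finite_nbrs[OF wf i] eq(4) t(1)])
  have "x (Suc t) = a + mat_E G i t *\<^sub>v \<xi> t"
    using dyn(1) t by (simp add: dynamics_def a_def)
  moreover have "x' (Suc t) = a + mat_E G i t *\<^sub>v \<xi>' t"
    using dyn(2) t unfolding a_def nv eq by (simp add: dynamics_def)
  ultimately have sum: "a + mat_E G i t *\<^sub>v \<xi> t = a + mat_E G i t *\<^sub>v \<xi>' t"
    using eq(2) by simp
  have dims: "\<xi> t \<in> carrier_vec (dim_d G i)" "\<xi>' t \<in> carrier_vec (dim_d G i)"
    using \<xi> t by (auto simp: signals_def PiE_iff)
  \<comment> \<open>Componentwise, cancelling \<open>a\<close> is cancellation in the reals.\<close>
  have "mat_E G i t *\<^sub>v \<xi> t = mat_E G i t *\<^sub>v \<xi>' t"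
  proof (rule eq_vecI)
    fix k assume "k < dim_vec (mat_E G i t *\<^sub>v \<xi>' t)"
    then show "(mat_E G i t *\<^sub>v \<xi> t) $ k = (mat_E G i t *\<^sub>v \<xi>' t) $ k"
      using arg_cong[OF sum, of "\<lambda>v. v $ k"] by simp
  qed simp
  then show ?thesis
    using full_column_rank_inj[OF E(2)] dims E(1) by simp
qed

section \<open>Causality of the closed loops\<close>

text \<open>
  The induction simulates the loop: the histories up to time \<open>t\<close> fix the input at time \<open>t\<close>, and this
  input and \<open>\<xi>\<^sub>t\<close> fix the next state. Disturbances up to time \<open>t - 1\<close> suffice because the state at
  time \<open>t\<close> was produced by the preceding update.
\<close>

lemma state_loop_causal:
  assumes fin: "finite (nbrs G i)"
    and L: "state_loop G i \<psi> \<xi> \<zeta> x u" "state_loop G i \<psi> \<xi>' \<zeta>' x' u'"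
    and t: "1 \<le> t" "t \<le> horizon G"
    and \<xi>: "history (t - 1) \<xi> = history (t - 1) \<xi>'"
    and \<zeta>: "nbr_history G i t \<zeta> = nbr_history G i t \<zeta>'"
  shows "history t x = history t x' \<and> u t = u' t"
  using t \<xi> \<zeta>
proof (induction t rule: nat_induct_at_least)
  case base
  have "history 1 x = history 1 x'"
    using L unfolding state_loop_def by (blast intro: dynamics_init)
  then show ?case
    using L base unfolding state_loop_def by simp
next
  case (Suc t)
  have prev: "history t x = history t x'" "u t = u' t"
    using Suc.IH Suc.prems history_eq_mono[of t \<xi> \<xi>' "t - 1"]
      nbr_history_eq_mono[of G i "Suc t" \<zeta> \<zeta>' t] by auto
  have "x (Suc t) = x' (Suc t)"
  proof (rule dynamics_step[OF fin _ _ Suc.hyps])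
    show "dynamics G i \<zeta> u \<xi> x" "dynamics G i \<zeta>' u' \<xi>' x'"
      using L by (auto simp: state_loop_def)
    show "x t = x' t" "\<xi> t = \<xi>' t"
      using prev(1) Suc.prems Suc.hyps by (auto simp: history_eq_iff)
    show "nbr_history G i t \<zeta> = nbr_history G i t \<zeta>'"
      using Suc.prems nbr_history_eq_mono[of G i "Suc t" \<zeta> \<zeta>' t] by simp
  qed (use prev Suc.prems in auto)
  then have "history (Suc t) x = history (Suc t) x'"
    using prev(1) history_SucI by blast
  then show ?case
    using L Suc.prems unfolding state_loop_def by simp
qed

text \<open>
  The converse direction of information: the observed states determine the disturbances one step
  behind. Knowing them is exactly what the policy needs to produce the input at time \<open>t\<close>, which in turn
  makes \<open>\<xi>\<^sub>t\<close> recoverable from the state at time \<open>t + 1\<close>.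
\<close>

lemma dist_loop_reconstruct:
  assumes wf: "wf_network G" and i: "i \<in> {1..agents G}"
    and L: "dist_loop G i \<Psi> \<xi> \<zeta> x u" "dist_loop G i \<Psi> \<xi>' \<zeta>' x' u'"
    and \<xi>: "\<xi> \<in> signals (horizon G) (dim_d G i)" "\<xi>' \<in> signals (horizon G) (dim_d G i)"
    and t: "1 \<le> t" "t \<le> horizon G"
    and x: "history t x = history t x'"
    and \<zeta>: "nbr_history G i t \<zeta> = nbr_history G i t \<zeta>'"
  shows "history (t - 1) \<xi> = history (t - 1) \<xi>' \<and> u t = u' t"
  using t x \<zeta>
proof (induction t rule: nat_induct_at_least)
  case base
  have "history 0 \<xi> = history 0 \<xi>'"
    by (simp add: history_eq_iff)
  then show ?case
    using L base unfolding dist_loop_def by simp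
next
  case (Suc t)
  have \<zeta>t: "nbr_history G i t \<zeta> = nbr_history G i t \<zeta>'"
    using Suc.prems nbr_history_eq_mono[of G i "Suc t" \<zeta> \<zeta>' t] by simp
  have prev: "history (t - 1) \<xi> = history (t - 1) \<xi>'" "u t = u' t"
    using Suc.IH Suc.prems \<zeta>t history_eq_mono[of "Suc t" x x' t] by auto
  have "\<xi> t = \<xi>' t"
  proof (rule dynamics_disturbance_cancel[OF wf i _ _ \<xi> Suc.hyps])
    show "dynamics G i \<zeta> u \<xi> x" "dynamics G i \<zeta>' u' \<xi>' x'"
      using L by (auto simp: dist_loop_def)
    show "x t = x' t" "x (Suc t) = x' (Suc t)"
      using Suc.prems Suc.hyps by (auto simp: history_eq_iff)
  qed (use prev Suc.prems \<zeta>t in auto)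
  then have "history t \<xi> = history t \<xi>'"
    using prev(1) Suc.hyps history_SucI[of "t - 1" \<xi> \<xi>'] by simp
  then show ?case
    using L Suc.prems unfolding dist_loop_def by simp
qed

text \<open>
  The inputs need to agree at time \<open>t\<close> only if the states do up to time \<open>t\<close>. This is what a state
  feedback policy guarantees, whose inputs are not known to agree beforehand.
\<close>

lemma dynamics_unique:
  assumes fin: "finite (nbrs G i)"
    and dyn: "dynamics G i \<zeta> u \<xi> x" "dynamics G i \<zeta> u' \<xi> x'"
    and u: "\<And>t. \<lbrakk>1 \<le> t; t \<le> horizon G; history t x = history t x'\<rbrakk> \<Longrightarrow> u t = u' t"
  shows "x = x'"
proof -
  have "1 \<le> t \<Longrightarrow> t \<le> horizon G + 1 \<Longrightarrow> history t x = history t x'" for t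
  proof (induction t rule: nat_induct_at_least)
    case base
    then show ?case using dynamics_init[OF dyn] by simp
  next
    case (Suc t)
    then have prev: "history t x = history t x'" by simp
    have "x (Suc t) = x' (Suc t)"
      using Suc.hyps Suc.prems prev u
      by (intro dynamics_step[OF fin dyn]) (auto simp: history_eq_iff)
    then show ?case using prev history_SucI by blast
  qed
  then show ?thesis
    using dyn by (intro signals_eqI[of x "horizon G + 1" "dim_x G i"]) (auto simp: dynamics_def)
qed

lemma state_loop_unique:
  assumes fin: "finite (nbrs G i)"
    and L: "state_loop G i \<psi> \<xi> \<zeta> x u" "state_loop G i \<psi> \<xi> \<zeta> x' u'"
  shows "x = x' \<and> u = u'"
proof
  show x: "x = x'"
    using L by (intro dynamics_unique[OF fin, of \<zeta> u \<xi> x u' x']) (auto simp: state_loop_def)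
  show "u = u'"
    using L x by (intro signals_eqI[of u "horizon G" "dim_u G i"])
      (auto simp: state_loop_def history_eq_iff)
qed

lemma dist_loop_unique:
  assumes fin: "finite (nbrs G i)"
    and L: "dist_loop G i \<Psi> \<xi> \<zeta> x u" "dist_loop G i \<Psi> \<xi> \<zeta> x' u'"
  shows "x = x' \<and> u = u'"
proof
  show "u = u'"
    using L by (intro signals_eqI[of u "horizon G" "dim_u G i"])
      (auto simp: dist_loop_def history_eq_iff)
  show "x = x'"
    using L by (intro dynamics_unique[OF fin, of \<zeta> u \<xi> x u' x']) (auto simp: dist_loop_def)
qed

section \<open>Policies read off from closed-loop runs\<close>

text \<open>
  The common core of both constructions. A policy acts on the neighbour histories and on its own
  data \<open>own t \<xi> x\<close>, which is a history of \<open>\<xi>\<close> or of \<open>x\<close>. If this data determines the input across all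
  runs, the policy can look up the input of any run with matching data. On data that no run shows it
  returns zero, so that its values always have the right dimension.
\<close>

lemma causal_policy_exists:
  fixes run :: "signal \<Rightarrow> (nat \<Rightarrow> signal) \<Rightarrow> signal \<Rightarrow> signal \<Rightarrow> bool"
    and own :: "nat \<Rightarrow> signal \<Rightarrow> signal \<Rightarrow> signal"
  assumes inputs: "\<And>\<xi> \<zeta> x u. run \<xi> \<zeta> x u \<Longrightarrow> u \<in> signals T n"
    and causal: "\<And>\<xi> \<zeta> x u \<xi>' \<zeta>' x' u' t.
      \<lbrakk>run \<xi> \<zeta> x u; run \<xi>' \<zeta>' x' u'; t \<in> {1..T}; own t \<xi> x = own t \<xi>' x';
       nbr_history G i t \<zeta> = nbr_history G i t \<zeta>'\<rbrakk> \<Longrightarrow> u t = u' t"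
  shows "\<exists>\<pi> :: policy. (\<forall>t\<in>{1..T}. \<forall>y z. \<pi> t y z \<in> carrier_vec n) \<and>
    (\<forall>\<xi> \<zeta> x u. run \<xi> \<zeta> x u \<longrightarrow> (\<forall>t\<in>{1..T}. \<pi> t (own t \<xi> x) (nbr_history G i t \<zeta>) = u t))"
proof -
  define match where "match t y z v \<longleftrightarrow>
    (\<exists>\<xi> \<zeta> x u. run \<xi> \<zeta> x u \<and> own t \<xi> x = y \<and> nbr_history G i t \<zeta> = z \<and> v = u t)" for t y z v
  have match_unique: "v = v'" if "match t y z v" "match t y z v'" "t \<in> {1..T}" for t y z v v'
  proof -
    obtain \<xi> \<zeta> x u where 1: "run \<xi> \<zeta> x u" "own t \<xi> x = y" "nbr_history G i t \<zeta> = z" "v = u t"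
      using \<open>match t y z v\<close> unfolding match_def by blast
    obtain \<xi>' \<zeta>' x' u' where 2: "run \<xi>' \<zeta>' x' u'" "own t \<xi>' x' = y" "nbr_history G i t \<zeta>' = z"
        "v' = u' t"
      using \<open>match t y z v'\<close> unfolding match_def by blast
    show ?thesis
      using causal[OF 1(1) 2(1) \<open>t \<in> {1..T}\<close>] 1 2 by simp
  qed
  define \<pi> :: policy where
    "\<pi> t y z = (if \<exists>v. match t y z v then SOME v. match t y z v else 0\<^sub>v n)" for t y z
  have \<pi>: "match t y z (\<pi> t y z)" if "match t y z v" for t y z v
    using that someI[of "match t y z" v] unfolding \<pi>_def by auto
  show ?thesis
  proof (intro exI[of _ \<pi>] conjI ballI allI impI)
    show "\<pi> t y z \<in> carrier_vec n" if t: "t \<in> {1..T}" for t y z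
    proof (cases "\<exists>v. match t y z v")
      case True
      then have "match t y z (\<pi> t y z)" using \<pi> by blast
      then obtain \<xi> \<zeta> x u where "run \<xi> \<zeta> x u" "\<pi> t y z = u t"
        unfolding match_def by blast
      then show ?thesis
        using PiE_mem[OF inputs[unfolded signals_def] t] by metis
    qed (simp add: \<pi>_def)
    show "\<pi> t (own t \<xi> x) (nbr_history G i t \<zeta>) = u t" if "run \<xi> \<zeta> x u" "t \<in> {1..T}" for \<xi> \<zeta> x u t
    proof -
      have "match t (own t \<xi> x) (nbr_history G i t \<zeta>) (u t)"
        unfolding match_def using that(1) by blast
      from match_unique[OF \<pi>[OF this] this that(2)] show ?thesis .
    qed
  qed
qed

text \<open>
  Every run of the state feedback loop is by construction a run of the disturbance feedback loop.
  The converse needs existence: the run of the state feedback loop is also a run of the other loop, and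
  that loop has no second one.
\<close>

lemma dist_policy_of_state_policy:
  assumes wf: "wf_network G" and i: "i \<in> {1..agents G}"
    and ex: "\<And>\<xi> \<zeta>. \<xi> \<in> S \<Longrightarrow> \<zeta> \<in> Z \<Longrightarrow> \<exists>x u. state_loop G i \<psi> \<xi> \<zeta> x u"
  shows "\<exists>\<Psi>\<in>dist_policies G i. \<forall>\<xi>\<in>S. \<forall>\<zeta>\<in>Z. dist_loop G i \<Psi> \<xi> \<zeta> = state_loop G i \<psi> \<xi> \<zeta>"
proof -
  note fin = finite_nbrs[OF wf i]
  have inputs: "u \<in> signals (horizon G) (dim_u G i)" if "state_loop G i \<psi> \<xi> \<zeta> x u" for \<xi> \<zeta> x u
    using that by (simp add: state_loop_def)
  have causal: "u t = u' t"
    if "state_loop G i \<psi> \<xi> \<zeta> x u" "state_loop G i \<psi> \<xi>' \<zeta>' x' u'" "t \<in> {1..horizon G}"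
      "history (t - 1) \<xi> = history (t - 1) \<xi>'" "nbr_history G i t \<zeta> = nbr_history G i t \<zeta>'"
    for \<xi> \<zeta> x u \<xi>' \<zeta>' x' u' t
    using state_loop_causal[OF fin that(1,2) _ _ that(4,5)] that(3) by simp
  have "\<exists>\<Psi> :: policy. (\<forall>t\<in>{1..horizon G}. \<forall>y z. \<Psi> t y z \<in> carrier_vec (dim_u G i)) \<and>
      (\<forall>\<xi> \<zeta> x u. state_loop G i \<psi> \<xi> \<zeta> x u \<longrightarrow>
        (\<forall>t\<in>{1..horizon G}. \<Psi> t (history (t - 1) \<xi>) (nbr_history G i t \<zeta>) = u t))"
    by (rule causal_policy_exists[of "state_loop G i \<psi>" "horizon G" "dim_u G i"
          "\<lambda>t \<xi> x. history (t - 1) \<xi>" G i]) (fact inputs causal)+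
  then obtain \<Psi> :: policy where
    range: "\<forall>t\<in>{1..horizon G}. \<forall>y z. \<Psi> t y z \<in> carrier_vec (dim_u G i)" and
    run: "\<forall>\<xi> \<zeta> x u. state_loop G i \<psi> \<xi> \<zeta> x u \<longrightarrow>
      (\<forall>t\<in>{1..horizon G}. \<Psi> t (history (t - 1) \<xi>) (nbr_history G i t \<zeta>) = u t)"
    by (elim exE conjE)
  have sub: "dist_loop G i \<Psi> \<xi> \<zeta> x u" if "state_loop G i \<psi> \<xi> \<zeta> x u" for \<xi> \<zeta> x u
    using run[rule_format, OF that] that unfolding dist_loop_def state_loop_def by simp
  have "dist_loop G i \<Psi> \<xi> \<zeta> = state_loop G i \<psi> \<xi> \<zeta>" if in_sets: "\<xi> \<in> S" "\<zeta> \<in> Z" for \<xi> \<zeta>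
  proof -
    obtain x u where xu: "state_loop G i \<psi> \<xi> \<zeta> x u"
      using ex[OF in_sets] by blast
    have "state_loop G i \<psi> \<xi> \<zeta> x' u'" if "dist_loop G i \<Psi> \<xi> \<zeta> x' u'" for x' u'
      using dist_loop_unique[OF fin that sub[OF xu]] xu by simp
    with sub show ?thesis by blast
  qed
  moreover have "\<Psi> \<in> dist_policies G i"
    using range by (simp add: dist_policies_def Pi_iff)
  ultimately show ?thesis by blast
qed

text \<open>
  The lookup ranges over runs with disturbance in \<open>S\<close> only, since recovering a disturbance
  from \<open>E\<^sub>t \<xi>\<^sub>t\<close> presupposes that it has the dimension of the disturbance space.
\<close>

lemma state_policy_of_dist_policy:
  assumes wf: "wf_network G" and i: "i \<in> {1..agents G}"
    and S: "S \<subseteq> signals (horizon G) (dim_d G i)"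
    and ex: "\<And>\<xi> \<zeta>. \<xi> \<in> S \<Longrightarrow> \<zeta> \<in> Z \<Longrightarrow> \<exists>x u. dist_loop G i \<Psi> \<xi> \<zeta> x u"
  shows "\<exists>\<psi>\<in>state_policies G i. \<forall>\<xi>\<in>S. \<forall>\<zeta>\<in>Z. state_loop G i \<psi> \<xi> \<zeta> = dist_loop G i \<Psi> \<xi> \<zeta>"
proof -
  note fin = finite_nbrs[OF wf i]
  define L where "L \<xi> \<zeta> x u \<longleftrightarrow> \<xi> \<in> S \<and> dist_loop G i \<Psi> \<xi> \<zeta> x u" for \<xi> \<zeta> x u
  have inputs: "u \<in> signals (horizon G) (dim_u G i)" if "L \<xi> \<zeta> x u" for \<xi> \<zeta> x u
    using that by (simp add: L_def dist_loop_def)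
  have causal: "u t = u' t"
    if L: "L \<xi> \<zeta> x u" "L \<xi>' \<zeta>' x' u'" and t: "t \<in> {1..horizon G}"
      and hist: "history t x = history t x'" "nbr_history G i t \<zeta> = nbr_history G i t \<zeta>'"
    for \<xi> \<zeta> x u \<xi>' \<zeta>' x' u' t
  proof -
    have loops: "dist_loop G i \<Psi> \<xi> \<zeta> x u" "dist_loop G i \<Psi> \<xi>' \<zeta>' x' u'"
      using L by (simp_all add: L_def)
    have "\<xi> \<in> signals (horizon G) (dim_d G i)" "\<xi>' \<in> signals (horizon G) (dim_d G i)"
      using L S unfolding L_def by blast+
    then show ?thesis
      using dist_loop_reconstruct[OF wf i loops _ _ _ _ hist] t by simp
  qed
  have "\<exists>\<psi> :: policy. (\<forall>t\<in>{1..horizon G}. \<forall>y z. \<psi> t y z \<in> carrier_vec (dim_u G i)) \<and>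
      (\<forall>\<xi> \<zeta> x u. L \<xi> \<zeta> x u \<longrightarrow>
        (\<forall>t\<in>{1..horizon G}. \<psi> t (history t x) (nbr_history G i t \<zeta>) = u t))"
    by (rule causal_policy_exists[of L "horizon G" "dim_u G i" "\<lambda>t \<xi> x. history t x" G i])
      (fact inputs causal)+
  then obtain \<psi> :: policy where
    range: "\<forall>t\<in>{1..horizon G}. \<forall>y z. \<psi> t y z \<in> carrier_vec (dim_u G i)" and
    run: "\<forall>\<xi> \<zeta> x u. L \<xi> \<zeta> x u \<longrightarrow>
      (\<forall>t\<in>{1..horizon G}. \<psi> t (history t x) (nbr_history G i t \<zeta>) = u t)"
    by (elim exE conjE)
  have sub: "state_loop G i \<psi> \<xi> \<zeta> x u" if "L \<xi> \<zeta> x u" for \<xi> \<zeta> x u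
    using run[rule_format, OF that] that unfolding L_def dist_loop_def state_loop_def by simp
  have "state_loop G i \<psi> \<xi> \<zeta> = dist_loop G i \<Psi> \<xi> \<zeta>" if in_sets: "\<xi> \<in> S" "\<zeta> \<in> Z" for \<xi> \<zeta>
  proof -
    obtain x u where xu: "L \<xi> \<zeta> x u"
      using ex[OF in_sets] in_sets(1) unfolding L_def by blast
    have "dist_loop G i \<Psi> \<xi> \<zeta> x' u'" if "state_loop G i \<psi> \<xi> \<zeta> x' u'" for x' u'
      using state_loop_unique[OF fin that sub[OF xu]] xu unfolding L_def by simp
    with sub in_sets(1) show ?thesis unfolding L_def by blast
  qed
  moreover have "\<psi> \<in> state_policies G i"
    using range by (simp add: state_policies_def Pi_iff)
  ultimately show ?thesis by blast
qed

section \<open>Equivalence of the two problems\<close>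

lemma equal_loops_imp_equal_objective:
  assumes "\<And>i \<xi> \<zeta>. \<lbrakk>i \<in> {1..agents G}; \<xi> \<in> dist_set G i; \<zeta> \<in> beliefs G X i\<rbrakk>
    \<Longrightarrow> dist_loop G i (\<Psi> i) \<xi> \<zeta> = state_loop G i (\<psi> i) \<xi> \<zeta>"
  shows "dist_objective G \<Psi> X = state_objective G \<psi> X"
  unfolding dist_objective_def state_objective_def
proof (intro sum.cong refl arg_cong[of _ _ Sup] Collect_cong)
  fix i c assume "i \<in> {1..agents G}"
  then show "(\<exists>\<xi> \<zeta> x u. c = ereal (cost G i x u) \<and> \<xi> \<in> dist_set G i \<and> \<zeta> \<in> beliefs G X i \<and>
        dist_loop G i (\<Psi> i) \<xi> \<zeta> x u) \<longleftrightarrow>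
      (\<exists>\<xi> \<zeta> x u. c = ereal (cost G i x u) \<and> \<xi> \<in> dist_set G i \<and> \<zeta> \<in> beliefs G X i \<and>
        state_loop G i (\<psi> i) \<xi> \<zeta> x u)"
    using assms by (metis (no_types, lifting))
qed

theorem theorem2:
  fixes G :: network
  assumes "wf_network G"
  shows
    "(\<forall>\<psi> X. state_feasible G \<psi> X \<longrightarrow>
        (\<exists>\<Psi>. dist_feasible G \<Psi> X \<and> dist_objective G \<Psi> X = state_objective G \<psi> X)) \<and>
     (\<forall>\<Psi> X. dist_feasible G \<Psi> X \<longrightarrow>
        (\<exists>\<psi>. state_feasible G \<psi> X \<and> state_objective G \<psi> X = dist_objective G \<Psi> X))"
proof (intro conjI allI impI)
  fix \<psi> X assume feas: "state_feasible G \<psi> X"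
  have "\<forall>i\<in>{1..agents G}. \<exists>\<Psi>. \<Psi> \<in> dist_policies G i \<and>
      (\<forall>\<xi>\<in>dist_set G i. \<forall>\<zeta>\<in>beliefs G X i. dist_loop G i \<Psi> \<xi> \<zeta> = state_loop G i (\<psi> i) \<xi> \<zeta>)"
  proof
    fix i assume i: "i \<in> {1..agents G}"
    have "\<exists>x u. state_loop G i (\<psi> i) \<xi> \<zeta> x u" if "\<xi> \<in> dist_set G i" "\<zeta> \<in> beliefs G X i" for \<xi> \<zeta>
      using feas i that unfolding state_feasible_def by blast
    from dist_policy_of_state_policy[OF assms i this]
    show "\<exists>\<Psi>. \<Psi> \<in> dist_policies G i \<and>
      (\<forall>\<xi>\<in>dist_set G i. \<forall>\<zeta>\<in>beliefs G X i. dist_loop G i \<Psi> \<xi> \<zeta> = state_loop G i (\<psi> i) \<xi> \<zeta>)"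
      by blast
  qed
  then obtain \<Psi> where \<Psi>: "\<And>i. i \<in> {1..agents G} \<Longrightarrow> \<Psi> i \<in> dist_policies G i"
      "\<And>i \<xi> \<zeta>. \<lbrakk>i \<in> {1..agents G}; \<xi> \<in> dist_set G i; \<zeta> \<in> beliefs G X i\<rbrakk>
        \<Longrightarrow> dist_loop G i (\<Psi> i) \<xi> \<zeta> = state_loop G i (\<psi> i) \<xi> \<zeta>"
    unfolding bchoice_iff by blast
  have "dist_feasible G \<Psi> X"
    using feas \<Psi> unfolding state_feasible_def dist_feasible_def by simp
  moreover have "dist_objective G \<Psi> X = state_objective G \<psi> X"
    by (rule equal_loops_imp_equal_objective) (rule \<Psi>(2))
  ultimately show "\<exists>\<Psi>. dist_feasible G \<Psi> X \<and> dist_objective G \<Psi> X = state_objective G \<psi> X"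
    by blast
next
  fix \<Psi> X assume feas: "dist_feasible G \<Psi> X"
  have "\<forall>i\<in>{1..agents G}. \<exists>\<psi>. \<psi> \<in> state_policies G i \<and>
      (\<forall>\<xi>\<in>dist_set G i. \<forall>\<zeta>\<in>beliefs G X i. state_loop G i \<psi> \<xi> \<zeta> = dist_loop G i (\<Psi> i) \<xi> \<zeta>)"
  proof
    fix i assume i: "i \<in> {1..agents G}"
    have S: "dist_set G i \<subseteq> signals (horizon G) (dim_d G i)"
      using assms i by (simp add: wf_network_def compact_signals_def)
    have "\<exists>x u. dist_loop G i (\<Psi> i) \<xi> \<zeta> x u" if "\<xi> \<in> dist_set G i" "\<zeta> \<in> beliefs G X i" for \<xi> \<zeta>
      using feas i that unfolding dist_feasible_def by blast
    from state_policy_of_dist_policy[OF assms i S this]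
    show "\<exists>\<psi>. \<psi> \<in> state_policies G i \<and>
      (\<forall>\<xi>\<in>dist_set G i. \<forall>\<zeta>\<in>beliefs G X i. state_loop G i \<psi> \<xi> \<zeta> = dist_loop G i (\<Psi> i) \<xi> \<zeta>)"
      by blast
  qed
  then obtain \<psi> where \<psi>: "\<And>i. i \<in> {1..agents G} \<Longrightarrow> \<psi> i \<in> state_policies G i"
      "\<And>i \<xi> \<zeta>. \<lbrakk>i \<in> {1..agents G}; \<xi> \<in> dist_set G i; \<zeta> \<in> beliefs G X i\<rbrakk>
        \<Longrightarrow> state_loop G i (\<psi> i) \<xi> \<zeta> = dist_loop G i (\<Psi> i) \<xi> \<zeta>"
    unfolding bchoice_iff by blast
  have "state_feasible G \<psi> X"
    using feas \<psi> unfolding state_feasible_def dist_feasible_def by simp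
  moreover have "dist_objective G \<Psi> X = state_objective G \<psi> X"
    by (rule equal_loops_imp_equal_objective) (rule \<psi>(2)[symmetric])
  ultimately show "\<exists>\<psi>. state_feasible G \<psi> X \<and> state_objective G \<psi> X = dist_objective G \<Psi> X"
    by (intro exI[of _ \<psi>]) simp
qed

end
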